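(* Let $c>0$, let $m\ge 1$, and let the generative model $\mathcal{G}$ be $c$-close for the data distribution $\mathcal{D}$. Let $S$ and $X$ be the random variables for $s$ and $x$ in the privacy game, and let $T^b \triangleq B(S,X)$ be the vector of guesses from the baseline. Then, for all $v\in\mathbb{R}$ and all $t^b$ in the support of $T^b$, $$\mathbb{P}_{S,X,T^b}\Big[\sum_{i=1}^m T^b_i\cdot S_i\ge v \ \Big|\ T^b=t^b\Big]\ \le\ \underset{S'\sim \mathrm{Bernoulli}\left(\frac{e^c}{1+e^c}\right)^m}{\mathbb{P}}\Big[\sum_{i=1}^m t^b_i\cdot S'_i\ge v\Big].$$
   Context: $\mathcal{D}$ (data distribution) and $\mathcal{G}$ (generative model) are probability distributions on a data space $\mathcal{X}$; $\mathbb{P}_{\mathcal{D}}[x]$ and $\mathbb{P}_{\mathcal{G}}[x]$ denote the probabilities (masses) they assign to the point $x$, and distributions are treated as discrete, so "$t$ in the support of $T$" means $\mathbb{P}[T=t]>0$. $c$-closeness: for $c>0$, $\mathcal{G}$ is $c$-close for $\mathcal{D}$ if for all $x\in\mathcal{X}$, $e^{-c}\,\mathbb{P}_{\mathcal{D}}[x]\le \mathbb{P}_{\mathcal{G}}[x]$. Privacy game: $x^{\mathrm{in}}_1,\dots,x^{\mathrm{in}}_m$ are i.i.d. from $\mathcal{D}$, $x^{\mathrm{gen}}_1,\dots,x^{\mathrm{gen}}_m$ are i.i.d. from $\mathcal{G}$, and $s\sim\mathrm{Bernoulli}(\tfrac12)^m$, all independent. For each $i\in\{1,\dots,m\}$,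 $x_i=(1-s_i)x^{\mathrm{gen}}_i+s_i x^{\mathrm{in}}_i$ (that is, $x_i=x^{\mathrm{in}}_i$ if $s_i=1$ and $x_i=x^{\mathrm{gen}}_i$ if $s_i=0$). $S,X$ denote the random variables $s=(s_1,\dots,s_m)$ and $x=(x_1,\dots,x_m)$. Baseline: $B(s,x):\{0,1\}^m\times\mathcal{X}^m\to\mathbb{R}_+^m$ is $B(s,x)=(b(x_1),b(x_2),\dots,b(x_m))$, where $b$ is a (potentially randomized) map to non-negative scores; the $i$-th score is based on $x_i$ only, with any internal randomness independent across indices and of everything else. $\mathrm{Bernoulli}(p)^m$ is the law of $m$ i.i.d. Bernoulli($p$) variables in $\{0,1\}$. *)

theory Defs
  imports "HOL-Probability.Probability"
begin

text \<open>
  Distributions are discrete, hence probability mass functions; the data space is the type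
  \<open>'a\<close>.  Vectors indexed by \<open>1..m\<close> are functions on \<open>nat\<close> that take a fixed default value
  outside \<open>{1..m}\<close>, which is the encoding used by \<^const>\<open>Pi_pmf\<close> for product distributions.
  Bits are booleans, with \<open>True\<close> for 1.
\<close>

definition c_close :: "real \<Rightarrow> 'a pmf \<Rightarrow> 'a pmf \<Rightarrow> bool" where
  "c_close c G D \<longleftrightarrow> (\<forall>x. exp (- c) * pmf D x \<le> pmf G x)"

definition bernoulli_vec :: "nat \<Rightarrow> real \<Rightarrow> (nat \<Rightarrow> bool) pmf" where
  "bernoulli_vec m p = Pi_pmf {1..m} False (\<lambda>_. bernoulli_pmf p)"

definition privacy_game ::
    "nat \<Rightarrow> 'a pmf \<Rightarrow> 'a pmf \<Rightarrow> ((nat \<Rightarrow> bool) \<times> (nat \<Rightarrow> 'a)) pmf" where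
  "privacy_game m D G = do {
     xin \<leftarrow> Pi_pmf {1..m} undefined (\<lambda>_. D);
     xgen \<leftarrow> Pi_pmf {1..m} undefined (\<lambda>_. G);
     s \<leftarrow> bernoulli_vec m (1 / 2);
     return_pmf (s, \<lambda>i. if s i then xin i else xgen i)
   }"

text \<open>
  A randomized score map sends a point to the distribution of its score; a deterministic one is
  the case \<open>b x = return_pmf (f x)\<close>.  The product makes the internal randomness independent
  across indices.  The bits \<open>s\<close> are an argument of the baseline that it does not use.
\<close>

definition baseline ::
    "nat \<Rightarrow> ('a \<Rightarrow> real pmf) \<Rightarrow> (nat \<Rightarrow> bool) \<Rightarrow> (nat \<Rightarrow> 'a) \<Rightarrow> (nat \<Rightarrow> real) pmf" where
  "baseline m b s x = Pi_pmf {1..m} 0 (\<lambda>i. b (x i))"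

text \<open>The joint law of \<open>(S, X, T)\<close> with \<open>T = B(S, X)\<close>.\<close>

definition game_with_baseline ::
    "nat \<Rightarrow> 'a pmf \<Rightarrow> 'a pmf \<Rightarrow> ('a \<Rightarrow> real pmf)
      \<Rightarrow> ((nat \<Rightarrow> bool) \<times> (nat \<Rightarrow> 'a) \<times> (nat \<Rightarrow> real)) pmf" where
  "game_with_baseline m D G b = do {
     (s, x) \<leftarrow> privacy_game m D G;
     t \<leftarrow> baseline m b s x;
     return_pmf (s, x, t)
   }"

definition baseline_guesses ::
    "nat \<Rightarrow> 'a pmf \<Rightarrow> 'a pmf \<Rightarrow> ('a \<Rightarrow> real pmf) \<Rightarrow> (nat \<Rightarrow> real) pmf" where
  "baseline_guesses m D G b = map_pmf (\<lambda>(s, x, t). t) (game_with_baseline m D G b)"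

end

theory Submission
  imports Defs
begin

text \<open>
  Given \<open>T = tb\<close>, Bayes' rule makes the bits independent, the \<open>i\<close>-th one being Bernoulli with
  parameter \<open>q i = p1 / (p1 + p0)\<close>, where \<open>p1\<close> and \<open>p0\<close> are the probabilities of the score \<open>tb i\<close>
  on a point of \<open>D\<close> and of \<open>G\<close>.  Closeness gives \<open>p1 \<le> exp c * p0\<close>, that is
  \<open>q i \<le> exp c / (1 + exp c)\<close>.  A Bernoulli vector with the smaller parameters arises from one
  with the larger parameter by switching bits off, and since \<open>tb \<ge> 0\<close> this can only decrease
  the weighted sum of the bits.
\<close>

text \<open>Only the branch \<open>x = a\<close> can land in the slice. With a singleton
  \<open>E\<close> this is the chain rule for masses; with a general \<open>E\<close> it turns
  conditioning on the first coordinate into cancelling \<open>pmf A a\<close>.\<close>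

lemma measure_bind_Pair_slice:
  "measure_pmf.prob (A \<bind> (\<lambda>x. map_pmf (Pair x) (B x))) ({a} \<times> E)
     = pmf A a * measure_pmf.prob (B a) E"
proof -
  have "emeasure (measure_pmf (A \<bind> (\<lambda>x. map_pmf (Pair x) (B x)))) ({a} \<times> E)
      = (\<integral>\<^sup>+x. indicator {a} x * emeasure (B a) E \<partial>A)"
    by (auto simp: vimage_def indicator_def intro!: nn_integral_cong)
  also have "\<dots> = ennreal (pmf A a * measure_pmf.prob (B a) E)"
    by (simp add: nn_integral_multc measure_pmf_single
        measure_pmf.emeasure_eq_measure ennreal_mult' mult.commute)
  finally show ?thesis
    by (simp add: measure_def)
qed

lemma pmf_bind_Pair:
  "pmf (A \<bind> (\<lambda>x. map_pmf (Pair x) (B x))) (x, y) = pmf A x * pmf (B x) y"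
  using measure_bind_Pair_slice[of A B x "{y}"] by (simp add: measure_pmf_single)

text \<open>Reverses the order of sampling: a joint law is determined by its point masses, so two
  factorizations of these masses give the same law.\<close>

lemma bind_Pair_swap_eqI:
  assumes "\<And>x y. pmf A x * pmf (B x) y = pmf A' y * pmf (B' y) x"
  shows "A \<bind> (\<lambda>x. map_pmf (\<lambda>y. (y, x)) (B x)) = A' \<bind> (\<lambda>y. map_pmf (Pair y) (B' y))"
proof (rule pmf_eqI)
  fix z :: "'b \<times> 'a"
  obtain y x where z: "z = (y, x)" by fastforce
  have "A \<bind> (\<lambda>x. map_pmf (\<lambda>y. (y, x)) (B x))
      = map_pmf prod.swap (A \<bind> (\<lambda>x. map_pmf (Pair x) (B x)))"
    by (simp add: map_bind_pmf pmf.map_comp o_def)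
  moreover have "pmf (map_pmf prod.swap (A \<bind> (\<lambda>x. map_pmf (Pair x) (B x)))) (prod.swap (x, y))
      = pmf A x * pmf (B x) y"
    by (subst pmf_map_inj') (simp_all add: pmf_bind_Pair)
  ultimately show "pmf (A \<bind> (\<lambda>x. map_pmf (\<lambda>y. (y, x)) (B x))) z
      = pmf (A' \<bind> (\<lambda>y. map_pmf (Pair y) (B' y))) z"
    by (simp add: z pmf_bind_Pair assms)
qed

text \<open>Bayes' rule is multiplied over the coordinates in \<open>I\<close>. If \<open>f\<close>
  or \<open>g\<close> leaves its default value outside \<open>I\<close>, both sides vanish.\<close>

lemma pmf_Pi_mult_swap:
  assumes "finite I"
    and "\<And>i x y. pmf (A i) x * pmf (B i x) y = pmf (A' i) y * pmf (B' i y) x"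
  shows "pmf (Pi_pmf I a A) f * pmf (Pi_pmf I b (\<lambda>i. B i (f i))) g
    = pmf (Pi_pmf I b A') g * pmf (Pi_pmf I a (\<lambda>i. B' i (g i))) f"
  using assms
  by (cases "(\<forall>i. i \<notin> I \<longrightarrow> f i = a) \<and> (\<forall>i. i \<notin> I \<longrightarrow> g i = b)")
    (auto simp: pmf_Pi simp flip: prod.distrib)

lemma pmf_bernoulli_Bayes:
  fixes W :: "bool \<Rightarrow> 'a pmf"
  shows "pmf (bernoulli_pmf (1/2)) s * pmf (W s) y
    = pmf (bernoulli_pmf (1/2) \<bind> W) y
      * pmf (bernoulli_pmf (pmf (W True) y / (pmf (W True) y + pmf (W False) y))) s"
proof -
  let ?p = "\<lambda>s. pmf (W s) y"
  have r: "pmf (bernoulli_pmf (1/2) \<bind> W) y = (?p True + ?p False) / 2"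
    by (simp add: pmf_bind)
  have q: "0 \<le> ?p True / (?p True + ?p False)" "?p True / (?p True + ?p False) \<le> 1"
    using pmf_nonneg[of "W True" y] pmf_nonneg[of "W False" y]
    by (auto simp: divide_le_eq_1 simp del: pmf_nonneg)
  \<comment> \<open>If neither bit can produce \<open>y\<close>, the posterior parameter is 0/0 = 0,
    but then both sides carry a zero factor.\<close>
  show ?thesis
  proof (cases "?p True + ?p False = 0")
    case True
    then have "?p True = 0" "?p False = 0"
      by (simp_all add: add_nonneg_eq_0_iff)
    then show ?thesis
      by (cases s) (simp_all add: r)
  next
    case False
    with q show ?thesis
      by (cases s) (simp_all add: r field_simps)
  qed
qed

text \<open>Closeness survives randomized post-processing: both masses are averages of
  \<open>pmf (b x) y\<close>, and the bound holds weight by weight. Nonnegative integrals avoid any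
  summability question.\<close>

lemma pmf_bind_le_of_c_close:
  fixes b :: "'a \<Rightarrow> 'b pmf"
  assumes "c_close c G D"
  shows "pmf (D \<bind> b) y \<le> exp c * pmf (G \<bind> b) y"
proof -
  have le: "pmf D x \<le> exp c * pmf G x" for x
  proof -
    have "exp c * (exp (- c) * pmf D x) \<le> exp c * pmf G x"
      using assms by (auto simp: c_close_def)
    then show ?thesis
      by (simp add: mult.assoc[symmetric] flip: exp_add)
  qed
  have "ennreal (pmf (D \<bind> b) y) = (\<integral>\<^sup>+x. ennreal (pmf D x) * ennreal (pmf (b x) y) \<partial>count_space UNIV)"
    by (simp add: ennreal_pmf_bind nn_integral_measure_pmf)
  also have "\<dots> \<le> (\<integral>\<^sup>+x. ennreal (exp c) * (ennreal (pmf G x) * ennreal (pmf (b x) y)) \<partial>count_space UNIV)"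
    using le by (intro nn_integral_mono)
      (auto simp: mult.assoc[symmetric] ennreal_leI simp flip: ennreal_mult' intro!: mult_right_mono)
  also have "\<dots> = ennreal (exp c * pmf (G \<bind> b) y)"
    by (simp add: nn_integral_cmult ennreal_pmf_bind nn_integral_measure_pmf ennreal_mult')
  finally show ?thesis
    by (simp add: ennreal_le_iff)
qed

text \<open>A random move that never enters \<open>E\<close> from outside cannot raise the
  probability of \<open>E\<close>.\<close>

lemma measure_bind_pmf_le_upset:
  assumes "\<And>x y. x \<in> set_pmf A \<Longrightarrow> y \<in> set_pmf (K x) \<Longrightarrow> y \<in> E \<Longrightarrow> x \<in> E"
  shows "measure_pmf.prob (A \<bind> K) E \<le> measure_pmf.prob A E"
proof -
  have "emeasure (K x) E \<le> indicator E x" if "x \<in> set_pmf A" for x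
  proof (cases "x \<in> E")
    case True
    then show ?thesis by (simp add: measure_pmf.emeasure_le_1)
  next
    case False
    with that assms have "measure_pmf.prob (K x) E = 0"
      unfolding measure_pmf_zero_iff by blast
    then show ?thesis
      by (simp add: measure_pmf.emeasure_eq_measure)
  qed
  then have "emeasure (measure_pmf (A \<bind> K)) E \<le> (\<integral>\<^sup>+x. indicator E x \<partial>A)"
    unfolding emeasure_bind_pmf by (intro nn_integral_mono_AE) (simp add: AE_measure_pmf_iff)
  then show ?thesis
    by (simp add: measure_pmf.emeasure_eq_measure)
qed

text \<open>A \<open>p\<close>-coin that shows heads is kept with probability \<open>q / p\<close>,
  so heads survive with probability \<open>q\<close>. For \<open>p = 0\<close> also
  \<open>q = 0\<close>, and the heads branch has weight 0.\<close>

lemma bernoulli_pmf_thinning: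
  assumes "0 \<le> q" "q \<le> p" "p \<le> 1"
  shows "bernoulli_pmf q
    = bernoulli_pmf p \<bind> (\<lambda>s. if s then bernoulli_pmf (q / p) else return_pmf False)"
proof (rule pmf_eqI)
  fix s
  have "0 \<le> q / p" "q / p \<le> 1"
    using assms by (auto simp: divide_le_eq_1)
  then show "pmf (bernoulli_pmf q) s
      = pmf (bernoulli_pmf p \<bind> (\<lambda>s. if s then bernoulli_pmf (q / p) else return_pmf False)) s"
    using assms by (cases s; cases "p = 0") (auto simp: pmf_bind field_simps)
qed

lemma measure_Pi_bernoulli_mono:
  assumes "finite I" "\<And>i. 0 \<le> q i" "\<And>i. q i \<le> p i" "\<And>i. p i \<le> 1"
    and up: "\<And>f g. f \<in> E \<Longrightarrow> f \<le> g \<Longrightarrow> g \<in> E"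
  shows "measure_pmf.prob (Pi_pmf I False (\<lambda>i. bernoulli_pmf (q i))) E
    \<le> measure_pmf.prob (Pi_pmf I False (\<lambda>i. bernoulli_pmf (p i))) E"
proof -
  let ?K = "\<lambda>i s. if s then bernoulli_pmf (q i / p i) else return_pmf False"
  have "Pi_pmf I False (\<lambda>i. bernoulli_pmf (q i))
      = Pi_pmf I False (\<lambda>i. bernoulli_pmf (p i) \<bind> ?K i)"
    using assms by (intro arg_cong[where f="Pi_pmf I False"] ext bernoulli_pmf_thinning)
  also have "\<dots> = Pi_pmf I False (\<lambda>i. bernoulli_pmf (p i))
      \<bind> (\<lambda>f. Pi_pmf I False (\<lambda>i. ?K i (f i)))"
    using assms by (intro Pi_pmf_bind)
  also have "measure_pmf.prob \<dots> E \<le> measure_pmf.prob (Pi_pmf I False (\<lambda>i. bernoulli_pmf (p i))) E"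
  proof (rule measure_bind_pmf_le_upset)
    fix f g assume g: "g \<in> set_pmf (Pi_pmf I False (\<lambda>i. ?K i (f i)))" "g \<in> E"
    \<comment> \<open>Thinning leaves a false bit false, and outside \<open>I\<close> the bit of
      \<open>g\<close> is the default \<open>False\<close>.\<close>
    have "g i \<le> f i" for i
      using g(1) assms(1) by (cases "i \<in> I"; cases "f i") (auto simp: set_Pi_pmf PiE_dflt_def)
    then show "f \<in> E"
      using up g(2) by (auto simp: le_fun_def)
  qed
  finally show ?thesis .
qed

lemma Pi_pmf_selection:
  assumes "finite I"
  shows "do {f \<leftarrow> Pi_pmf I d (\<lambda>_. A); g \<leftarrow> Pi_pmf I d (\<lambda>_. B);
      return_pmf (\<lambda>i. if i \<in> I then if s i then f i else g i else d)}
    = Pi_pmf I d (\<lambda>i. if s i then A else B)"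
proof -
  \<comment> \<open>At each index both candidates are drawn and the unselected one is discarded,
    which leaves the law unchanged and matches the game.\<close>
  have "Pi_pmf I d (\<lambda>i. if s i then A else B)
      = Pi_pmf I d (\<lambda>i. A \<bind> (\<lambda>x. B \<bind> (\<lambda>y. return_pmf (if s i then x else y))))"
    by (intro arg_cong[where f="Pi_pmf I d"] ext) (simp add: bind_return_pmf')
  also have "\<dots> = do {f \<leftarrow> Pi_pmf I d (\<lambda>_. A);
      Pi_pmf I d (\<lambda>i. B \<bind> (\<lambda>y. return_pmf (if s i then f i else y)))}"
    using assms by (rule Pi_pmf_bind)
  also have "\<dots> = do {f \<leftarrow> Pi_pmf I d (\<lambda>_. A); g \<leftarrow> Pi_pmf I d (\<lambda>_. B);
      Pi_pmf I d (\<lambda>i. return_pmf (if s i then f i else g i))}"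
    using assms by (intro bind_pmf_cong refl Pi_pmf_bind)
  finally show ?thesis
    using assms by simp
qed

text \<open>Integrates out \<open>X\<close>: once the bits are fixed, the scores are independent,
  each drawn through \<open>b\<close> from the distribution selected by its bit.\<close>

lemma map_game_with_baseline:
  "map_pmf (\<lambda>(s, x, t). (t, s)) (game_with_baseline m D G b)
    = bernoulli_vec m (1/2) \<bind>
        (\<lambda>s. map_pmf (\<lambda>t. (t, s)) (Pi_pmf {1..m} 0 (\<lambda>i. (if s i then D else G) \<bind> b)))"
proof -
  let ?I = "{1..m}"
  let ?X = "\<lambda>s xin xgen i. if i \<in> ?I then if s i then xin i else xgen i else undefined"
  have "map_pmf (\<lambda>(s, x, t). (t, s)) (game_with_baseline m D G b)
      = do {xin \<leftarrow> Pi_pmf ?I undefined (\<lambda>_. D); xgen \<leftarrow> Pi_pmf ?I undefined (\<lambda>_. G);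
          s \<leftarrow> bernoulli_vec m (1/2);
          map_pmf (\<lambda>t. (t, s)) (Pi_pmf ?I 0 (\<lambda>i. b (if s i then xin i else xgen i)))}"
    by (simp add: game_with_baseline_def privacy_game_def baseline_def map_bind_pmf
        bind_assoc_pmf bind_return_pmf map_pmf_def)
  also have "\<dots> = do {s \<leftarrow> bernoulli_vec m (1/2);
      xin \<leftarrow> Pi_pmf ?I undefined (\<lambda>_. D); xgen \<leftarrow> Pi_pmf ?I undefined (\<lambda>_. G);
      map_pmf (\<lambda>t. (t, s)) (Pi_pmf ?I 0 (\<lambda>i. b (if s i then xin i else xgen i)))}"
    unfolding bind_commute_pmf[of "Pi_pmf ?I undefined (\<lambda>_. G)" "bernoulli_vec m (1/2)"]
    by (rule bind_commute_pmf)
  \<comment> \<open>Outside \<open>{1..m}\<close> the value of \<open>x\<close> may be set to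
    \<open>undefined\<close>, since the scores read \<open>x\<close> on that range only.\<close>
  also have "\<dots> = do {s \<leftarrow> bernoulli_vec m (1/2);
      x \<leftarrow> do {xin \<leftarrow> Pi_pmf ?I undefined (\<lambda>_. D); xgen \<leftarrow> Pi_pmf ?I undefined (\<lambda>_. G);
        return_pmf (?X s xin xgen)};
      map_pmf (\<lambda>t. (t, s)) (Pi_pmf ?I 0 (\<lambda>i. b (x i)))}"
    unfolding bind_assoc_pmf bind_return_pmf
    by (intro bind_pmf_cong refl arg_cong[where f="map_pmf _"] Pi_pmf_cong) auto
  also have "\<dots> = do {s \<leftarrow> bernoulli_vec m (1/2);
      map_pmf (\<lambda>t. (t, s)) (Pi_pmf ?I undefined (\<lambda>i. if s i then D else G)
        \<bind> (\<lambda>x. Pi_pmf ?I 0 (\<lambda>i. b (x i))))}"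
    by (simp only: Pi_pmf_selection[OF finite_atLeastAtMost] map_bind_pmf)
  also have "\<dots> = bernoulli_vec m (1/2) \<bind>
      (\<lambda>s. map_pmf (\<lambda>t. (t, s)) (Pi_pmf ?I 0 (\<lambda>i. (if s i then D else G) \<bind> b)))"
    by (simp add: Pi_pmf_bind[where d'=undefined])
  finally show ?thesis .
qed

theorem proposition1:
  fixes c v :: real and m :: nat
    and D G :: "'a pmf"
    and b :: "'a \<Rightarrow> real pmf"
    and tb :: "nat \<Rightarrow> real"
  assumes "c > 0"
    and "m \<ge> 1"
    and "c_close c G D"
    and "\<And>x. set_pmf (b x) \<subseteq> {0..}"
    and "tb \<in> set_pmf (baseline_guesses m D G b)"
  shows "\<P>((S, X, T) in game_with_baseline m D G b.
             (\<Sum>i=1..m. T i * of_bool (S i)) \<ge> v \<bar> T = tb)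
         \<le> \<P>(S' in bernoulli_vec m (exp c / (1 + exp c)).
             (\<Sum>i=1..m. tb i * of_bool (S' i)) \<ge> v)"
proof -
  let ?I = "{1..m}"
  let ?game = "game_with_baseline m D G b"
  define W where "W s = (if s then D else G) \<bind> b" for s
  define q where "q y = pmf (W True) y / (pmf (W True) y + pmf (W False) y)" for y
  define R where "R = Pi_pmf ?I 0 (\<lambda>_. bernoulli_pmf (1/2) \<bind> W)"
  define Q where "Q t = Pi_pmf ?I False (\<lambda>i. bernoulli_pmf (q (t i)))" for t
  define E where "E = {s. (\<Sum>i=1..m. tb i * of_bool (s i)) \<ge> v}"
  \<comment> \<open>The game in reverse order: first the scores from their marginal
    \<open>R\<close>, then the bits from their posterior \<open>Q\<close>.\<close>
  let ?J = "R \<bind> (\<lambda>t. map_pmf (Pair t) (Q t))"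

  have joint: "map_pmf (\<lambda>(s, x, t). (t, s)) ?game = ?J"
    unfolding map_game_with_baseline bernoulli_vec_def R_def Q_def q_def W_def[symmetric]
    by (intro bind_Pair_swap_eqI pmf_Pi_mult_swap[where B="\<lambda>_. W"] pmf_bernoulli_Bayes) simp

  have "baseline_guesses m D G b = map_pmf fst ?J"
    unfolding joint[symmetric] baseline_guesses_def
    by (simp add: pmf.map_comp o_def case_prod_unfold)
  also have "\<dots> = R"
    by (simp add: map_bind_pmf pmf.map_comp o_def bind_return_pmf')
  finally have tb: "tb \<in> set_pmf R"
    using assms(5) by simp

  \<comment> \<open>Each coordinate of a supported \<open>tb\<close> is a possible score of some
    data point.\<close>
  have tb_nonneg: "tb i \<ge> 0" if "i \<in> ?I" for i
  proof -
    have "tb i \<in> set_pmf (bernoulli_pmf (1/2) \<bind> W)"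
      using tb that by (auto simp: R_def set_Pi_pmf PiE_dflt_def)
    then show ?thesis
      using assms(4) by (fastforce simp: W_def split: if_splits)
  qed

  have slice: "measure_pmf.prob ?game {z. case z of (s, x, t) \<Rightarrow> s \<in> F \<and> t = tb}
      = pmf R tb * measure_pmf.prob (Q tb) F" for F
  proof -
    have "measure_pmf.prob ?J ({tb} \<times> F)
        = measure_pmf.prob ?game {z. case z of (s, x, t) \<Rightarrow> s \<in> F \<and> t = tb}"
      unfolding joint[symmetric] by (auto intro!: arg_cong[where f="measure_pmf.prob ?game"])
    then show ?thesis
      by (simp add: measure_bind_Pair_slice)
  qed

  \<comment> \<open>Numerator and denominator are slices, with \<open>F = E\<close> and
    \<open>F = UNIV\<close>; their common factor \<open>pmf R tb\<close> is nonzero because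
    \<open>tb\<close> is in the support.\<close>
  have "\<P>((S, X, T) in ?game. (\<Sum>i=1..m. T i * of_bool (S i)) \<ge> v \<bar> T = tb)
      = measure_pmf.prob ?game {z. case z of (s, x, t) \<Rightarrow> s \<in> E \<and> t = tb}
        / measure_pmf.prob ?game {z. case z of (s, x, t) \<Rightarrow> s \<in> UNIV \<and> t = tb}"
    unfolding cond_prob_def E_def
    by (intro arg_cong2[where f="(/)"] arg_cong[where f="measure_pmf.prob ?game"]) auto
  also have "\<dots> = measure_pmf.prob (Q tb) E"
    using tb unfolding slice by (simp add: set_pmf_iff)
  also have "\<dots> \<le> measure_pmf.prob (bernoulli_vec m (exp c / (1 + exp c))) E"
    unfolding Q_def bernoulli_vec_def
  proof (rule measure_Pi_bernoulli_mono)
    fix i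
    let ?p1 = "pmf (W True) (tb i)" and ?p0 = "pmf (W False) (tb i)"
    show "0 \<le> q (tb i)"
      by (simp add: q_def)
    have "?p1 \<le> exp c * ?p0"
      using pmf_bind_le_of_c_close[OF assms(3)] by (simp add: W_def)
    \<comment> \<open>The target bound on \<open>q (tb i)\<close> with denominators cleared;
      \<open>exp c * ?p1\<close> occurs on both sides.\<close>
    then have *: "?p1 * (1 + exp c) \<le> exp c * (?p1 + ?p0)"
      by (simp add: algebra_simps)
    show "q (tb i) \<le> exp c / (1 + exp c)"
    proof (cases "?p1 + ?p0 = 0")
      case False
      then have "?p1 + ?p0 > 0"
        by (simp add: less_le)
      moreover have "1 + exp c > 0"
        by (simp add: add_pos_pos)
      ultimately show ?thesis
        using * by (simp add: q_def frac_le_eq divide_le_eq pos_le_divide_eq field_simps)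
    qed (simp add: q_def add_nonneg_nonneg)
    show "exp c / (1 + exp c) \<le> 1"
      by (simp add: divide_le_eq_1 add_pos_pos)
  next
    \<comment> \<open>Turning bits on adds nonnegative weights \<open>tb i\<close>, so
      \<open>E\<close> is upward closed.\<close>
    fix f g :: "nat \<Rightarrow> bool" assume "f \<in> E" "f \<le> g"
    then show "g \<in> E"
      unfolding E_def mem_Collect_eq
      by (elim order_trans, intro sum_mono mult_left_mono tb_nonneg) (auto simp: le_fun_def)
  qed simp
  finally show ?thesis
    by (simp add: E_def)
qed

end
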